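(* Let $q\ge1$ be a fixed integer. The number of closed lambda-terms with exactly $q$ unary nodes and size $n$ is $0$ if $n\equiv q\pmod 2$; otherwise it is asymptotically equivalent to $$\frac{\sqrt2}{2^q\sqrt{(q-1)!}\,\sqrt{\pi n^3}}\,(2\sqrt q)^n,$$ as $n\to\infty$ (with $n\not\equiv q\pmod 2$).
   Context: A Motzkin tree is a finite plane rooted tree in which every node has 0, 1 or 2 children (leaf, unary node, binary node). A closed lambda-term (up to $\alpha$-equivalence) is a Motzkin tree together with a map assigning to every leaf one unary node on the path from the root to that leaf (the abstraction binding it). The size of a term is the total number of nodes of the tree. *)

theory Defs
  imports
    Complex_Main
    "HOL-Library.FuncSet"
    "HOL-Library.Sublist"
    "HOL-Library.Landau_Symbols"
    "HOL-Number_Theory.Cong"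
begin

datatype motzkin = Leaf | Unary motzkin | Binary motzkin motzkin

text \<open>A node is identified with its address: the list of child indices along the path from the
  root. The child of a unary node and the left child of a binary node have index 0, the right child
  of a binary node has index 1.\<close>

fun nodes :: "motzkin \<Rightarrow> nat list set" where
  "nodes Leaf = {[]}"
| "nodes (Unary t) = insert [] (Cons 0 ` nodes t)"
| "nodes (Binary l r) = insert [] (Cons 0 ` nodes l \<union> Cons 1 ` nodes r)"

fun leaves :: "motzkin \<Rightarrow> nat list set" where
  "leaves Leaf = {[]}"
| "leaves (Unary t) = Cons 0 ` leaves t"
| "leaves (Binary l r) = Cons 0 ` leaves l \<union> Cons 1 ` leaves r"

fun unary_nodes :: "motzkin \<Rightarrow> nat list set" where
  "unary_nodes Leaf = {}"
| "unary_nodes (Unary t) = insert [] (Cons 0 ` unary_nodes t)"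
| "unary_nodes (Binary l r) = Cons 0 ` unary_nodes l \<union> Cons 1 ` unary_nodes r"

text \<open>A node lies on the path from the root to a leaf iff its address is a prefix of the address
  of the leaf. Binding maps are extensional functions, so that two of them are equal iff they agree
  on all leaves; hence every alpha-equivalence class is represented exactly once.\<close>

definition bindings :: "motzkin \<Rightarrow> (nat list \<Rightarrow> nat list) set" where
  "bindings t = (\<Pi>\<^sub>E l\<in>leaves t. {u \<in> unary_nodes t. prefix u l})"

definition closed_terms :: "(motzkin \<times> (nat list \<Rightarrow> nat list)) set" where
  "closed_terms = (SIGMA t:UNIV. bindings t)"

definition closed_terms_of :: "nat \<Rightarrow> nat \<Rightarrow> (motzkin \<times> (nat list \<Rightarrow> nat list)) set" where
  "closed_terms_of q n =
     {(t, b) \<in> closed_terms. card (unary_nodes t) = q \<and> card (nodes t) = n}"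

lemma finite_nodes: "finite (nodes t)"
  by (induction t) auto

lemma finite_leaves: "finite (leaves t)"
  by (induction t) auto

lemma finite_unary_nodes: "finite (unary_nodes t)"
  by (induction t) auto

lemma size_less_card_nodes: "size t < card (nodes t)"
proof (induction t)
  case (Unary t)
  have "card (nodes (Unary t)) = Suc (card (nodes t))"
    by (simp add: finite_nodes card_insert_if card_image image_iff)
  then show ?case using Unary by simp
next
  case (Binary l r)
  have "card (Cons 0 ` nodes l \<union> Cons 1 ` nodes r) = card (nodes l) + card (nodes r)"
    by (subst card_Un_disjoint) (auto simp: finite_nodes card_image)
  then have "card (nodes (Binary l r)) = Suc (card (nodes l) + card (nodes r))"
    by (simp add: finite_nodes card_insert_if image_iff)
  then show ?case using Binary by simp
qed simp

lemma finite_motzkin_size_le: "finite {t :: motzkin. size t \<le> n}"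
proof (induction n)
  case 0
  have "{t :: motzkin. size t \<le> 0} \<subseteq> {Leaf}"
  proof
    fix t :: motzkin
    assume "t \<in> {t. size t \<le> 0}"
    then show "t \<in> {Leaf}" by (cases t) auto
  qed
  then show ?case using finite_subset by blast
next
  case (Suc n)
  let ?S = "{t :: motzkin. size t \<le> n}"
  have "{t :: motzkin. size t \<le> Suc n} \<subseteq>
      {Leaf} \<union> Unary ` ?S \<union> (\<lambda>(l, r). Binary l r) ` (?S \<times> ?S)"
  proof
    fix t :: motzkin
    assume "t \<in> {t. size t \<le> Suc n}"
    then show "t \<in> {Leaf} \<union> Unary ` ?S \<union> (\<lambda>(l, r). Binary l r) ` (?S \<times> ?S)"
      by (cases t) auto
  qed
  then show ?case using Suc by (meson finite.emptyI finite.insertI finite_SigmaI finite_UnI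
        finite_imageI finite_subset)
qed

text \<open>The sets being counted are finite, so their \<^const>\<open>card\<close> is a genuine cardinality.\<close>

lemma finite_closed_terms_of: "finite (closed_terms_of q n)"
proof (rule finite_subset)
  show "closed_terms_of q n \<subseteq> (SIGMA t:{t. size t \<le> n}. bindings t)"
    using size_less_card_nodes less_imp_le
    by (auto simp: closed_terms_of_def closed_terms_def)
  show "finite (SIGMA t:{t. size t \<le> n}. bindings t)"
    by (auto intro!: finite_SigmaI finite_PiE
        simp: finite_motzkin_size_le bindings_def finite_leaves finite_unary_nodes)
qed

unbundle asymp_equiv_syntax

end

theory Submission
  imports
    Defs
    "HOL-Analysis.Analysis"
    "HOL-Real_Asymp.Real_Asymp"
begin

text \<open>Let \<open>G\<^bsub>k,q\<^esub>(x)\<close> count, by the number of binary nodes, the terms with \<open>q\<close> unary nodes whose leaves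
  may also be bound by \<open>k\<close> outer abstractions. Then
  \<open>G\<^bsub>k,q\<^esub> = G\<^bsub>k+1,q-1\<^esub> + x \<Sum>\<^sub>i G\<^bsub>k,i\<^esub> G\<^bsub>k,q-i\<^esub>\<close>, with \<open>k\<close> in place of the first summand if \<open>q = 0\<close>. Hence
  \<open>1 - 2 x G\<^bsub>k,0\<^esub> = (1 - 4 k x)\<^bsup>1/2\<^esup>\<close>, and for \<open>q > 0\<close>, \<open>G\<^bsub>k,q\<^esub>\<close> is \<open>(1 - 4 k x)\<^bsup>-1/2\<^esup>\<close> times the sum of
  \<open>G\<^bsub>k+1,q-1\<^esub>\<close> and \<open>x\<close> times products of series \<open>G\<^bsub>k,i\<^esub>\<close> with \<open>i < q\<close>. As \<open>G\<^bsub>k,j\<^esub>\<close> converges for \<open>\<bar>x\<bar> < 1 / (4 (k + j))\<close>, these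
  products are negligible at \<open>x = 1 / (4 (k + q))\<close>. Going from \<open>G\<^bsub>q,0\<^esub>\<close> to \<open>G\<^bsub>0,q\<^esub>\<close> along \<open>k + j = q\<close>, each step
  therefore multiplies the leading coefficient by \<open>(1 - k / q)\<^bsup>-1/2\<^esup>\<close>, while \<open>G\<^bsub>q,0\<^esub>\<close> itself is given by
  binomial coefficients.\<close>

unbundle fps_syntax
unbundle no vec_syntax

section \<open>Counting terms by tree shape\<close>

fun unary_count :: "motzkin \<Rightarrow> nat" where
  "unary_count Leaf = 0"
| "unary_count (Unary t) = Suc (unary_count t)"
| "unary_count (Binary l r) = unary_count l + unary_count r"

fun binary_count :: "motzkin \<Rightarrow> nat" where
  "binary_count Leaf = 0"
| "binary_count (Unary t) = binary_count t"
| "binary_count (Binary l r) = Suc (binary_count l + binary_count r)"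

lemma card_Cons_Un:
  fixes a b :: 'a
  assumes "a \<noteq> b" "finite A" "finite B"
  shows "card (Cons a ` A \<union> Cons b ` B) = card A + card B"
  using assms by (subst card_Un_disjoint) (auto simp: card_image)

lemma card_unary_nodes: "card (unary_nodes t) = unary_count t"
  by (induction t)
    (simp_all add: finite_unary_nodes card_Cons_Un card_insert_if card_image image_iff)

text \<open>A tree with \<open>m\<close> binary nodes has \<open>m + 1\<close> leaves, whence the
  odd term \<open>2 * m + 1\<close>.\<close>

lemma card_nodes: "card (nodes t) = 2 * binary_count t + 1 + unary_count t"
  by (induction t) (simp_all add: finite_nodes card_Cons_Un card_insert_if card_image image_iff)

text \<open>The number of ways to bind the leaves of a tree that sits below \<open>k\<close> further unary nodes.\<close>

fun binding_weight :: "nat \<Rightarrow> motzkin \<Rightarrow> nat" where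
  "binding_weight k Leaf = k"
| "binding_weight k (Unary t) = binding_weight (Suc k) t"
| "binding_weight k (Binary l r) = binding_weight k l * binding_weight k r"

text \<open>The surplus \<open>k\<close> makes the induction work: below a unary root every leaf
  gains the binder \<open>[]\<close>, which amounts to replacing \<open>k\<close> by
  \<open>Suc k\<close>.\<close>

lemma prod_binders_eq_binding_weight:
  "(\<Prod>l\<in>leaves t. k + card {u \<in> unary_nodes t. prefix u l}) = binding_weight k t"
proof (induction t arbitrary: k)
  case (Unary t)
  have "card {u \<in> unary_nodes (Unary t). prefix u (0 # l)} =
      Suc (card {u \<in> unary_nodes t. prefix u l})" for l
  proof -
    have "{u \<in> unary_nodes (Unary t). prefix u (0 # l)} =
        insert [] (Cons 0 ` {u \<in> unary_nodes t. prefix u l})"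
      by auto
    then show ?thesis
      by (simp add: finite_unary_nodes card_insert_if card_image image_iff)
  qed
  then show ?case
    using Unary[of "Suc k"] by (simp add: prod.reindex)
next
  case (Binary t1 t2)
  have "{u \<in> unary_nodes (Binary t1 t2). prefix u (0 # l)} =
      Cons 0 ` {u \<in> unary_nodes t1. prefix u l}" for l
    by auto
  moreover have "{u \<in> unary_nodes (Binary t1 t2). prefix u (1 # l)} =
      Cons 1 ` {u \<in> unary_nodes t2. prefix u l}" for l
    by auto
  moreover have "leaves (Binary t1 t2) = Cons 0 ` leaves t1 \<union> Cons 1 ` leaves t2"
    "Cons (0::nat) ` leaves t1 \<inter> Cons 1 ` leaves t2 = {}"
    by auto
  ultimately show ?case
    using Binary
    by (simp add: prod.union_disjoint finite_leaves prod.reindex card_image del: unary_nodes.simps)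
qed simp

lemma card_bindings: "card (bindings t) = binding_weight 0 t"
  using prod_binders_eq_binding_weight[of 0 t]
  by (simp add: bindings_def card_PiE finite_leaves)

lemma finite_bindings: "finite (bindings t)"
  by (simp add: bindings_def finite_PiE finite_leaves finite_unary_nodes)

definition trees :: "nat \<Rightarrow> nat \<Rightarrow> motzkin set" where
  "trees q m = {t. unary_count t = q \<and> binary_count t = m}"

lemma finite_trees: "finite (trees q m)"
proof (rule finite_subset)
  show "trees q m \<subseteq> {t. size t \<le> 2 * m + 1 + q}"
  proof
    fix t assume "t \<in> trees q m"
    then show "t \<in> {t. size t \<le> 2 * m + 1 + q}"
      using size_less_card_nodes[of t] by (simp add: trees_def card_nodes)
  qed
qed (rule finite_motzkin_size_le)

lemma closed_terms_of_eq:
  "closed_terms_of q n =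
    (SIGMA t:{t. unary_count t = q \<and> 2 * binary_count t + 1 + q = n}. bindings t)"
  by (auto simp: closed_terms_of_def closed_terms_def card_unary_nodes card_nodes)

lemma closed_terms_of_parity:
  assumes "[n = q] (mod 2)"
  shows "closed_terms_of q n = {}"
proof -
  have "2 * binary_count t + 1 + q \<noteq> n" for t
  proof
    assume "2 * binary_count t + 1 + q = n"
    then have "even n \<longleftrightarrow> odd q"
      by presburger
    with cong_dvd_iff[OF assms] show False
      by simp
  qed
  then show ?thesis by (auto simp: closed_terms_of_eq)
qed

text \<open>The coefficient of \<open>X ^ m\<close> belongs to trees with \<open>m\<close> binary nodes, that is, of size
  \<open>2 * m + 1 + q\<close>.\<close>

definition gf :: "nat \<Rightarrow> nat \<Rightarrow> real fps" where
  "gf k q = Abs_fps (\<lambda>m. \<Sum>t\<in>trees q m. real (binding_weight k t))"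

lemma card_closed_terms_of:
  "real (card (closed_terms_of q (2 * m + 1 + q))) = gf 0 q $ m"
proof -
  have "{t. unary_count t = q \<and> 2 * binary_count t + 1 + q = 2 * m + 1 + q} = trees q m"
    by (auto simp: trees_def)
  then have "card (closed_terms_of q (2 * m + 1 + q)) = (\<Sum>t\<in>trees q m. binding_weight 0 t)"
    unfolding closed_terms_of_eq
    by (simp add: card_SigmaI finite_trees finite_bindings card_bindings)
  then show ?thesis by (simp add: gf_def)
qed

lemma trees_0:
  "trees q 0 = (case q of 0 \<Rightarrow> {Leaf} | Suc p \<Rightarrow> Unary ` trees p 0)"
proof (intro set_eqI)
  fix t show "t \<in> trees q 0 \<longleftrightarrow> t \<in> (case q of 0 \<Rightarrow> {Leaf} | Suc p \<Rightarrow> Unary ` trees p 0)"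
    by (cases t) (auto simp: trees_def split: nat.splits)
qed

lemma trees_Suc:
  "trees q (Suc m) = (case q of 0 \<Rightarrow> {} | Suc p \<Rightarrow> Unary ` trees p (Suc m)) \<union>
    (\<lambda>(l, r). Binary l r) ` {(l, r). unary_count l + unary_count r = q \<and>
      binary_count l + binary_count r = m}"
proof (intro set_eqI)
  fix t show "t \<in> trees q (Suc m) \<longleftrightarrow>
    t \<in> (case q of 0 \<Rightarrow> {} | Suc p \<Rightarrow> Unary ` trees p (Suc m)) \<union>
    (\<lambda>(l, r). Binary l r) ` {(l, r). unary_count l + unary_count r = q \<and>
      binary_count l + binary_count r = m}"
    by (cases t) (auto simp: trees_def image_iff split: nat.splits)
qed

text \<open>A Cauchy product in both statistics: pairs are grouped by the counts of the left tree,
  and each fibre is a full product of two sets of trees.\<close>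

lemma sum_tree_pairs:
  fixes f :: "motzkin \<Rightarrow> real"
  shows "(\<Sum>(l, r)\<in>{(l, r). unary_count l + unary_count r = q \<and>
      binary_count l + binary_count r = m}. f l * f r) =
    (\<Sum>i\<le>q. \<Sum>j\<le>m. sum f (trees i j) * sum f (trees (q - i) (m - j)))"
    (is "sum ?g ?S = _")
proof -
  have fin: "finite ?S"
  proof (rule finite_subset)
    show "?S \<subseteq> (\<Union>i\<le>q. \<Union>j\<le>m. trees i j) \<times> (\<Union>i\<le>q. \<Union>j\<le>m. trees i j)"
      by (auto simp: trees_def)
  qed (simp add: finite_trees)
  define S where "S = ?S"
  define h where "h = (\<lambda>(l, r :: motzkin). (unary_count l, binary_count l))"
  have fib: "{x \<in> S. h x = y} = (case y of (i, j) \<Rightarrow> trees i j \<times> trees (q - i) (m - j))"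
    if "y \<in> {..q} \<times> {..m}" for y
    using that by (auto simp: trees_def S_def h_def)
  have "sum ?g S = (\<Sum>y\<in>{..q} \<times> {..m}. sum ?g {x \<in> S. h x = y})"
    by (rule sum.group[symmetric]) (use fin in \<open>auto simp: S_def h_def\<close>)
  also have "\<dots> = (\<Sum>y\<in>{..q} \<times> {..m}. case y of (i, j) \<Rightarrow>
      sum ?g (trees i j \<times> trees (q - i) (m - j)))"
    by (intro sum.cong refl) (subst fib, auto)
  also have "\<dots> = (\<Sum>i\<le>q. \<Sum>j\<le>m. sum ?g (trees i j \<times> trees (q - i) (m - j)))"
    by (rule sum.cartesian_product[symmetric])
  also have "\<dots> = (\<Sum>i\<le>q. \<Sum>j\<le>m. sum f (trees i j) * sum f (trees (q - i) (m - j)))"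
    by (simp only: sum.cartesian_product[symmetric] sum_product)
  also have "S = ?S"
    by (rule S_def)
  finally show ?thesis .
qed

text \<open>Decomposition at the root: a leaf has \<open>k\<close> choices, a unary root becomes one
  more outer binder for its subtree, and a binary root costs one \<open>fps_X\<close> and shares out
  the unary nodes.\<close>

lemma gf_rec:
  "gf k q = (case q of 0 \<Rightarrow> fps_const (real k) | Suc p \<Rightarrow> gf (Suc k) p) +
    fps_X * (\<Sum>i\<le>q. gf k i * gf k (q - i))"
proof (rule fps_ext)
  fix m
  let ?w = "\<lambda>t. real (binding_weight k t)"
  show "gf k q $ m = ((case q of 0 \<Rightarrow> fps_const (real k) | Suc p \<Rightarrow> gf (Suc k) p) +
    fps_X * (\<Sum>i\<le>q. gf k i * gf k (q - i))) $ m"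
  proof (cases m)
    case 0
    then show ?thesis
      using trees_0[of q] by (cases q) (simp_all add: gf_def sum.reindex inj_on_def)
  next
    case (Suc n)
    let ?S = "{(l, r). unary_count l + unary_count r = q \<and> binary_count l + binary_count r = n}"
    let ?U = "case q of 0 \<Rightarrow> {} | Suc p \<Rightarrow> Unary ` trees p (Suc n)"
    have inj: "inj_on (\<lambda>(l, r). Binary l r) ?S"
      by (auto simp: inj_on_def)
    \<comment> \<open>Both parts of the union inherit finiteness from the whole.\<close>
    have "finite (trees q (Suc n))"
      by (rule finite_trees)
    then have fin: "finite ?U" "finite ((\<lambda>(l, r). Binary l r) ` ?S)"
      unfolding trees_Suc[of q n] by (rule finite_subset[rotated]; blast)+
    have "sum ?w (trees q m) = sum ?w ?U + sum ?w ((\<lambda>(l, r). Binary l r) ` ?S)"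
      unfolding Suc trees_Suc[of q n]
      by (intro sum.union_disjoint fin) (auto split: nat.splits)
    also have "sum ?w ?U = (case q of 0 \<Rightarrow> fps_const (real k) | Suc p \<Rightarrow> gf (Suc k) p) $ m"
      by (cases q) (simp_all add: Suc gf_def sum.reindex inj_on_def)
    also have "sum ?w ((\<lambda>(l, r). Binary l r) ` ?S) = (\<Sum>(l, r)\<in>?S. ?w l * ?w r)"
      by (subst sum.reindex[OF inj]) (simp add: case_prod_unfold)
    also have "\<dots> = (\<Sum>i\<le>q. (gf k i * gf k (q - i)) $ n)"
      unfolding sum_tree_pairs by (simp add: gf_def fps_mult_nth atMost_atLeast0)
    finally show ?thesis
      by (simp add: Suc gf_def[of k q] fps_sum_nth)
  qed
qed

section \<open>Coefficient asymptotics of products\<close>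

definition abs_conv :: "real \<Rightarrow> real fps \<Rightarrow> bool" where
  "abs_conv s F \<longleftrightarrow> summable (\<lambda>n. norm (F $ n * s ^ n))"

text \<open>The coefficients of a series with a square-root singularity at \<open>r\<close> grow like
  \<open>r ^ (- n) * n ^ (- 3 / 2)\<close>; \<open>Suc n\<close> avoids the junk value at \<open>n = 0\<close>.\<close>

definition coeff_limit :: "real \<Rightarrow> real fps \<Rightarrow> real \<Rightarrow> bool" where
  "coeff_limit r F L \<longleftrightarrow> (\<lambda>n. F $ n * r ^ n * real (Suc n) powr (3/2)) \<longlonglongrightarrow> L"

lemma abs_conv_const: "abs_conv s (fps_const c)"
proof -
  have "summable (\<lambda>n. norm (fps_const c $ n * s ^ n))"
    by (rule summable_finite[of "{0}"]) auto
  then show ?thesis by (simp add: abs_conv_def)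
qed

lemma abs_conv_X: "abs_conv s fps_X"
proof -
  have "summable (\<lambda>n. norm (fps_X $ n * s ^ n))"
    by (rule summable_finite[of "{1}"]) auto
  then show ?thesis by (simp add: abs_conv_def)
qed

lemma abs_conv_add:
  assumes "abs_conv s F" "abs_conv s G"
  shows "abs_conv s (F + G)"
  unfolding abs_conv_def
proof (rule summable_comparison_test')
  show "summable (\<lambda>n. norm (F $ n * s ^ n) + norm (G $ n * s ^ n))"
    using assms unfolding abs_conv_def by (rule summable_add)
  show "norm (norm ((F + G) $ n * s ^ n)) \<le> norm (F $ n * s ^ n) + norm (G $ n * s ^ n)" for n
    using norm_triangle_ineq[of "F $ n * s ^ n" "G $ n * s ^ n"] by (simp add: algebra_simps)
qed

lemma fps_mult_nth_scaled:
  fixes F G :: "real fps"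
  shows "(F * G) $ n * s ^ n = (\<Sum>i\<le>n. (F $ i * s ^ i) * (G $ (n - i) * s ^ (n - i)))"
proof -
  have "(F $ i * G $ (n - i)) * s ^ n = (F $ i * s ^ i) * (G $ (n - i) * s ^ (n - i))"
    if "i \<le> n" for i
  proof -
    have "s ^ n = s ^ i * s ^ (n - i)"
      using that by (simp flip: power_add)
    then show ?thesis by simp
  qed
  then show ?thesis
    unfolding fps_mult_nth sum_distrib_right atLeast0AtMost by (intro sum.cong) auto
qed

lemma abs_conv_mult:
  assumes "abs_conv s F" "abs_conv s G"
  shows "abs_conv s (F * G)"
  unfolding abs_conv_def
proof (rule summable_comparison_test')
  show "summable (\<lambda>n. \<Sum>i\<le>n. norm (F $ i * s ^ i) * norm (G $ (n - i) * s ^ (n - i)))"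
    using assms unfolding abs_conv_def by (intro summable_Cauchy_product) simp_all
  show "norm (norm ((F * G) $ n * s ^ n)) \<le>
      (\<Sum>i\<le>n. norm (F $ i * s ^ i) * norm (G $ (n - i) * s ^ (n - i)))" for n
    unfolding fps_mult_nth_scaled
    by (auto simp: abs_mult simp del: power_abs intro!: order_trans[OF sum_abs] sum_mono)
qed

lemma abs_conv_sum:
  assumes "\<And>i. i \<in> I \<Longrightarrow> abs_conv s (F i)"
  shows "abs_conv s (\<Sum>i\<in>I. F i)"
  using assms abs_conv_const[of s 0]
  by (induction I rule: infinite_finite_induct) (auto intro: abs_conv_add)

text \<open>The terms of a convergent series tend to 0, hence are bounded; this is the only form in
  which convergence at \<open>s\<close> enters the limit lemmas.\<close>

lemma abs_conv_bounded:
  assumes "abs_conv s F" "s > 0"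
  obtains C where "\<And>n. \<bar>F $ n\<bar> * s ^ n \<le> C"
proof -
  have "Bseq (\<lambda>n. norm (F $ n * s ^ n))"
    using assms(1) unfolding abs_conv_def
    by (intro convergent_imp_Bseq convergentI[of _ 0] summable_LIMSEQ_zero)
  then obtain C where "\<And>n. norm (norm (F $ n * s ^ n)) \<le> C"
    unfolding Bseq_def by blast
  then show ?thesis
    using assms(2) by (intro that[of C]) (simp add: abs_mult)
qed

lemma coeff_limit_add:
  assumes "coeff_limit r F L" "coeff_limit r G M"
  shows "coeff_limit r (F + G) (L + M)"
  using tendsto_add[OF assms[unfolded coeff_limit_def]]
  unfolding coeff_limit_def by (simp add: algebra_simps)

text \<open>Convergence beyond \<open>r\<close> leaves a geometric factor
  \<open>(r / s) ^ n\<close>, which beats the power of \<open>n\<close>.\<close>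

lemma coeff_limit_abs_conv:
  assumes "abs_conv s F" "0 < r" "r < s"
  shows "coeff_limit r F 0"
proof -
  have "s > 0" using assms by simp
  from abs_conv_bounded[OF assms(1) this] obtain C where C: "\<And>n. \<bar>F $ n\<bar> * s ^ n \<le> C"
    by blast
  define u where "u = r / s"
  have u: "0 < u" "u < 1" "r = u * s"
    using assms by (auto simp: u_def)
  show ?thesis
    unfolding coeff_limit_def
  proof (rule Lim_null_comparison)
    show "\<forall>\<^sub>F n in sequentially. norm (F $ n * r ^ n * real (Suc n) powr (3/2)) \<le>
        C * (u ^ n * real (Suc n) powr (3/2))"
    proof (intro always_eventually allI)
      fix n
      have "norm (F $ n * r ^ n * real (Suc n) powr (3/2)) =
          (\<bar>F $ n\<bar> * s ^ n) * (u ^ n * real (Suc n) powr (3/2))"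
        using u \<open>s > 0\<close> by (simp add: abs_mult power_mult_distrib)
      also have "\<dots> \<le> C * (u ^ n * real (Suc n) powr (3/2))"
        using u by (intro mult_right_mono C) auto
      finally show "norm (F $ n * r ^ n * real (Suc n) powr (3/2)) \<le>
          C * (u ^ n * real (Suc n) powr (3/2))" .
    qed
    have "(\<lambda>n. u ^ n * real (Suc n) powr (3/2)) \<longlonglongrightarrow> 0"
      using u by real_asymp
    then show "(\<lambda>n. C * (u ^ n * real (Suc n) powr (3/2))) \<longlonglongrightarrow> 0"
      by (rule tendsto_mult_right_zero)
  qed
qed

text \<open>Dominated convergence applies since \<open>(n + 1) / (n - i + 1) \<le> i + 1\<close>.\<close>

lemma coeff_limit_mult:
  assumes B: "abs_conv s B" and r: "0 < r" "r < s" and F: "coeff_limit r F L"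
  shows "coeff_limit r (B * F) ((\<Sum>n. B $ n * r ^ n) * L)"
proof -
  have "s > 0" using r by simp
  from abs_conv_bounded[OF B this] obtain C where C: "\<And>n. \<bar>B $ n\<bar> * s ^ n \<le> C"
    by blast
  define u where "u = r / s"
  have u: "0 < u" "u < 1" "r = u * s"
    using r by (auto simp: u_def)
  define f where "f n = F $ n * r ^ n * real (Suc n) powr (3/2)" for n
  have f: "f \<longlonglongrightarrow> L"
    using F by (simp add: coeff_limit_def f_def[abs_def])
  then have "Bseq f"
    by (intro convergent_imp_Bseq convergentI)
  then obtain K where K: "\<And>n. norm (f n) \<le> K" "K > 0"
    unfolding Bseq_def by blast
  define b where "b i = B $ i * r ^ i" for i
  have b: "\<bar>b i\<bar> \<le> C * u ^ i" for i
  proof -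
    have "\<bar>b i\<bar> = (\<bar>B $ i\<bar> * s ^ i) * u ^ i"
      using u \<open>s > 0\<close> by (simp add: b_def abs_mult power_mult_distrib)
    also have "\<dots> \<le> C * u ^ i"
      using u by (intro mult_right_mono C) auto
    finally show ?thesis .
  qed
  \<comment> \<open>The correction for shifting the polynomial factor from index
    \<open>n - i\<close> to \<open>n\<close>.\<close>
  define w where "w i n = (real (Suc n) / real (Suc (n - i))) powr (3/2)" for i n
  have w: "w i n \<le> real (Suc i) ^ 2" if "i \<le> n" for i n
  proof -
    have "real n + 1 \<le> (real i + 1) * (real (n - i) + 1)"
      using that by (simp add: of_nat_diff algebra_simps mult_left_mono)
    then have "real (Suc n) / real (Suc (n - i)) \<le> real (Suc i)"
      by (simp add: divide_le_eq add.commute)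
    then have "w i n \<le> real (Suc i) powr (3/2)"
      unfolding w_def by (intro powr_mono2) auto
    also have "\<dots> \<le> real (Suc i) powr 2"
      by (intro powr_mono) auto
    finally show ?thesis by simp
  qed
  \<comment> \<open>The convolution is padded with zeros to an infinite series, the form required by
    Tannery's theorem.\<close>
  define a where "a i n = (if i \<le> n then b i * f (n - i) * w i n else 0)" for i n
  have "(\<lambda>n. \<Sum>i. a i n) \<longlonglongrightarrow> (\<Sum>i. b i * L)"
  proof (rule tannerys_theorem[THEN conjunct2, THEN conjunct2])
    fix i
    have "(\<lambda>n. f (n - i)) \<longlonglongrightarrow> L"
      using f by (rule seq_offset_neg)
    moreover have "w i \<longlonglongrightarrow> 1"
    proof (rule Lim_transform_eventually)
      show "(\<lambda>n. (real (Suc n) / (real (Suc n) - real i)) powr (3/2)) \<longlonglongrightarrow> 1"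
        by real_asymp
      show "\<forall>\<^sub>F n in sequentially. (real (Suc n) / (real (Suc n) - real i)) powr (3/2) = w i n"
        using eventually_ge_at_top[of i]
        by eventually_elim (simp add: w_def of_nat_diff algebra_simps)
    qed
    ultimately have "(\<lambda>n. b i * f (n - i) * w i n) \<longlonglongrightarrow> b i * L * 1"
      by (intro tendsto_intros)
    then have "(\<lambda>n. b i * f (n - i) * w i n) \<longlonglongrightarrow> b i * L"
      by simp
    then show "a i \<longlonglongrightarrow> b i * L"
      by (rule Lim_transform_eventually)
        (use eventually_ge_at_top[of i] in eventually_elim, simp add: a_def)
  next
    have "norm (a i n) \<le> C * K * (u ^ i * real (Suc i) ^ 2)" for i n
    proof (cases "i \<le> n")
      case True
      have "norm (a i n) = \<bar>b i\<bar> * norm (f (n - i)) * w i n"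
        using True by (simp add: a_def abs_mult w_def)
      also have "\<dots> \<le> C * u ^ i * K * real (Suc i) ^ 2"
        using b[of i] K w[OF True]
        by (intro mult_mono) (auto simp: w_def intro: order_trans[OF abs_ge_zero])
      finally show ?thesis by (simp add: mult_ac)
    next
      case False
      have "0 \<le> C * u ^ i" using b[of i] by linarith
      then have "0 \<le> (C * u ^ i) * K * real (Suc i) ^ 2" using K by simp
      then show ?thesis using False by (simp add: a_def mult_ac)
    qed
    then show "\<forall>\<^sub>F (i, n) in at_top \<times>\<^sub>F sequentially.
        norm (a i n) \<le> C * K * (u ^ i * real (Suc i) ^ 2)"
      by (intro always_eventually) auto
  next
    show "summable (\<lambda>i. C * K * (u ^ i * real (Suc i) ^ 2))"
    proof (intro summable_mult)
      \<comment> \<open>With \<open>u = v * v\<close>, one factor \<open>v ^ i\<close> absorbs the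
        polynomial and the other remains as a geometric majorant.\<close>
      define v where "v = sqrt u"
      have v: "0 < v" "v < 1" "u = v * v"
        using u by (auto simp: v_def)
      have "(\<lambda>i. v ^ i * real (Suc i) ^ 2) \<in> O(\<lambda>_. 1)"
        using v by real_asymp
      then have "(\<lambda>i. v ^ i * (v ^ i * real (Suc i) ^ 2)) \<in> O(\<lambda>i. v ^ i * 1)"
        by (rule landau_o.big.mult_left)
      then have "(\<lambda>i. u ^ i * real (Suc i) ^ 2) \<in> O(\<lambda>i. v ^ i)"
        by (simp add: v(3) power_mult_distrib mult.assoc)
      moreover have "summable (\<lambda>i. norm (v ^ i))"
        using v by (simp add: norm_power summable_geometric)
      ultimately show "summable (\<lambda>i. u ^ i * real (Suc i) ^ 2)"
        by (rule summable_comparison_test_bigo[rotated])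
    qed
  qed simp
  moreover have "(\<Sum>i. a i n) = (B * F) $ n * r ^ n * real (Suc n) powr (3/2)" for n
  proof -
    have "(\<Sum>i. a i n) = (\<Sum>i\<le>n. a i n)"
      by (rule suminf_finite) (auto simp: a_def)
    also have "\<dots> = (\<Sum>i\<le>n. (b i * (F $ (n - i) * r ^ (n - i))) * real (Suc n) powr (3/2))"
      by (intro sum.cong refl) (simp add: a_def f_def w_def powr_divide)
    also have "\<dots> = (B * F) $ n * r ^ n * real (Suc n) powr (3/2)"
      by (simp add: fps_mult_nth_scaled sum_distrib_right b_def)
    finally show ?thesis .
  qed
  moreover have "(\<Sum>i. b i * L) = (\<Sum>i. b i) * L"
  proof (rule suminf_mult2[symmetric], rule summable_comparison_test')
    show "summable (\<lambda>i. C * u ^ i)"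
      using u by (intro summable_mult summable_geometric) simp
    show "norm (b i) \<le> C * u ^ i" for i
      using b by simp
  qed
  ultimately show ?thesis
    by (simp add: coeff_limit_def b_def)
qed

section \<open>Asymptotics of the generating functions\<close>

definition binom_fps :: "real \<Rightarrow> real \<Rightarrow> real fps" where
  "binom_fps a c = Abs_fps (\<lambda>n. c ^ n * (a gchoose n))"

text \<open>As a composition, the series inherits the exponent laws of
  \<open>fps_binomial\<close>.\<close>

lemma binom_fps_eq_compose: "binom_fps a c = fps_compose (fps_binomial a) (fps_const c * fps_X)"
  by (simp add: binom_fps_def fps_compose_linear)

lemma binom_fps_mult: "binom_fps a c * binom_fps b c = binom_fps (a + b) c"
  by (simp add: binom_fps_eq_compose fps_binomial_add_mult fps_compose_mult_distrib)

lemma binom_fps_0: "binom_fps 0 c = 1"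
  by (simp add: binom_fps_eq_compose)

lemma binom_fps_1: "binom_fps 1 c = 1 + fps_const c * fps_X"
  by (simp add: binom_fps_eq_compose fps_binomial_1 fps_compose_add_distrib)

lemma abs_conv_binom_fps:
  assumes "s \<ge> 0" "\<bar>c\<bar> * s < 1"
  shows "abs_conv s (binom_fps a c)"
proof -
  have "ereal (norm (c * s)) < conv_radius (\<lambda>n. a gchoose n)"
    using assms by (simp add: conv_radius_gchoose abs_mult)
  from abs_summable_in_conv_radius[OF this] show ?thesis
    by (simp add: abs_conv_def binom_fps_def power_mult_distrib mult_ac)
qed

lemma binom_fps_sums:
  assumes "\<bar>c * x\<bar> < 1"
  shows "(\<lambda>n. binom_fps a c $ n * x ^ n) sums (1 + c * x) powr a"
  using gen_binomial_real[OF assms, of a] by (simp add: binom_fps_def power_mult_distrib mult_ac)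

text \<open>Completing the square in \<open>G = k + X * G ^ 2\<close> shows that both sides have the
  square \<open>1 - 4 * k * X\<close>.\<close>

lemma gf_0_sqrt: "1 - 2 * fps_X * gf k 0 = binom_fps (1/2) (- 4 * real k)"
proof -
  let ?B = "binom_fps (1/2) (- 4 * real k)"
  let ?C = "1 - 2 * fps_X * gf k 0"
  have "gf k 0 = fps_const (real k) + fps_X * gf k 0 ^ 2"
    using gf_rec[of k 0] by (simp add: power2_eq_square)
  then have k: "fps_X * gf k 0 ^ 2 = gf k 0 - fps_const (real k)"
    by (metis add_diff_cancel_left')
  have "?C ^ 2 = 1 - 4 * fps_X * gf k 0 + 4 * fps_X * (fps_X * gf k 0 ^ 2)"
    by (simp add: power2_eq_square algebra_simps)
  also have "\<dots> = 1 - 4 * fps_const (real k) * fps_X"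
    unfolding k by (simp add: algebra_simps)
  also have "\<dots> = ?B ^ 2"
    by (simp add: power2_eq_square binom_fps_mult binom_fps_1 numeral_fps_const algebra_simps
        flip: fps_const_mult fps_const_neg)
  finally have "?C = ?B \<or> ?C = - ?B"
    by (simp add: power2_eq_iff)
  \<comment> \<open>The constant terms are 1 and -1, which selects the branch.\<close>
  moreover have "?C $ 0 \<noteq> (- ?B) $ 0"
    by (simp add: binom_fps_def)
  ultimately show ?thesis by metis
qed

lemma gf_0_nth: "gf k 0 $ n = - (1/2) * binom_fps (1/2) (- 4 * real k) $ Suc n"
  unfolding gf_0_sqrt[symmetric] by (simp add: mult.assoc numeral_fps_const)

text \<open>The two extreme summands of \<open>gf_rec\<close> contain the unknown \<open>gf k (Suc p)\<close>; moving them to the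
  left produces the factor \<open>1 - 2 * X * gf k 0\<close>.\<close>

lemma gf_Suc:
  "gf k (Suc p) = binom_fps (- 1/2) (- 4 * real k) *
    (gf (Suc k) p + fps_X * (\<Sum>i\<in>{1..p}. gf k i * gf k (Suc p - i)))"
proof -
  let ?R = "gf (Suc k) p + fps_X * (\<Sum>i\<in>{1..p}. gf k i * gf k (Suc p - i))"
  have "{..Suc p} = insert 0 (insert (Suc p) {1..p})"
    by auto
  then have "gf k (Suc p) = ?R + 2 * fps_X * gf k 0 * gf k (Suc p)"
    by (subst gf_rec) (simp add: algebra_simps)
  then have "(1 - 2 * fps_X * gf k 0) * gf k (Suc p) = ?R"
    by (simp add: algebra_simps)
  then have R: "binom_fps (1/2) (- 4 * real k) * gf k (Suc p) = ?R"
    unfolding gf_0_sqrt .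
  have "binom_fps (- 1/2) (- 4 * real k) * binom_fps (1/2) (- 4 * real k) = 1"
    by (simp add: binom_fps_mult binom_fps_0)
  then have "gf k (Suc p) = (binom_fps (- 1/2) (- 4 * real k) *
      binom_fps (1/2) (- 4 * real k)) * gf k (Suc p)"
    by (simp only: mult_1)
  also have "\<dots> = binom_fps (- 1/2) (- 4 * real k) * ?R"
    by (simp only: mult.assoc R)
  finally show ?thesis .
qed

lemma abs_conv_gf_0:
  assumes "s > 0" "4 * real k * s < 1"
  shows "abs_conv s (gf k 0)"
proof -
  let ?B = "binom_fps (1/2) (- 4 * real k)"
  have "summable (\<lambda>n. norm (?B $ n * s ^ n))"
    using abs_conv_binom_fps[of s "- 4 * real k" "1/2"] assms by (simp add: abs_conv_def)
  then have "summable (\<lambda>n. norm (?B $ Suc n * s ^ Suc n))"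
    by (subst summable_Suc_iff)
  then have "summable (\<lambda>n. 1 / (2 * s) * norm (?B $ Suc n * s ^ Suc n))"
    by (rule summable_mult)
  moreover have "1 / (2 * s) * norm (?B $ Suc n * s ^ Suc n) = norm (gf k 0 $ n * s ^ n)" for n
    using assms(1) by (simp add: gf_0_nth abs_mult)
  ultimately show ?thesis
    unfolding abs_conv_def by (simp only:)
qed

text \<open>Every series on the right of \<open>gf_Suc\<close> has index sum at most
  \<open>k + j\<close> and a smaller second index, so induction on \<open>j\<close> for all
  \<open>k\<close> applies.\<close>

lemma abs_conv_gf:
  assumes "s > 0" "4 * real (k + j) * s < 1"
  shows "abs_conv s (gf k j)"
  using assms(2)
proof (induction j arbitrary: k rule: less_induct)
  case (less j)
  show ?case
  proof (cases j)
    case 0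
    then show ?thesis
      using less.prems assms(1) by (simp add: abs_conv_gf_0)
  next
    case (Suc p)
    have le: "4 * real m * s < 1" if "m \<le> k + j" for m
    proof -
      have "4 * real m * s \<le> 4 * real (k + j) * s"
        using that assms(1) by (intro mult_right_mono) auto
      then show ?thesis using less.prems by simp
    qed
    have B: "abs_conv s (binom_fps (- 1/2) (- 4 * real k))"
      using le[of k] assms(1) by (intro abs_conv_binom_fps) auto
    have "abs_conv s (gf k i)" if "i < j" for i
      using that by (intro less.IH le) auto
    moreover have "abs_conv s (gf (Suc k) p)"
      using Suc by (intro less.IH le) auto
    ultimately show ?thesis
      unfolding Suc gf_Suc
      by (intro abs_conv_mult abs_conv_add abs_conv_sum abs_conv_X B) auto
  qed
qed

text \<open>The asymptotics of \<open>a gchoose n\<close> at \<open>a = 1/2\<close>, with constant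
  \<open>1 / Gamma (- 1/2)\<close>, read off one index later because of
  \<open>gf_0_nth\<close>.\<close>

lemma coeff_limit_gf_0:
  assumes "q > 0"
  shows "coeff_limit (1 / (4 * real q)) (gf q 0) (real q / sqrt pi)"
proof -
  have G: "inverse (Gamma (- (1/2)) :: real) = - 1 / (2 * sqrt pi)"
  proof -
    have "rGamma (1/2 :: real) = 1 / sqrt pi"
      by (simp only: rGamma_inverse_Gamma Gamma_one_half_real inverse_eq_divide)
    moreover have "- (1/2) * rGamma (1/2 :: real) = rGamma (- (1/2))"
      using rGamma_plus1[of "- (1/2) :: real"] by simp
    ultimately have "rGamma (- (1/2) :: real) = - 1 / (2 * sqrt pi)"
      by (metis divide_minus_left minus_mult_left mult_1 times_divide_times_eq)
    then show ?thesis by (simp only: rGamma_inverse_Gamma)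
  qed
  have "(\<lambda>n. ((1/2::real) gchoose Suc n) / ((- 1) ^ Suc n /
      exp ((1/2 + 1) * of_real (ln (real (Suc n)))))) \<longlonglongrightarrow> - 1 / (2 * sqrt pi)"
    using LIMSEQ_Suc[OF gbinomial_asymptotic[of "1/2::real"]] unfolding G .
  \<comment> \<open>The factor \<open>- 2 * q\<close> combines \<open>- 1/2\<close> from
    \<open>gf_0_nth\<close>, the surplus factor \<open>- 4 * q\<close> of the shifted power, and the
    sign between \<open>(- 1) ^ n\<close> and \<open>(- 1) ^ Suc n\<close>.\<close>
  then have "(\<lambda>n. - 2 * real q * (((1/2::real) gchoose Suc n) / ((- 1) ^ Suc n /
      exp ((1/2 + 1) * of_real (ln (real (Suc n))))))) \<longlonglongrightarrow>
      - 2 * real q * (- 1 / (2 * sqrt pi))"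
    by (rule tendsto_mult_left)
  also have "- 2 * real q * (- 1 / (2 * sqrt pi)) = real q / sqrt pi"
    by simp
  finally have "(\<lambda>n. - 2 * real q * (((1/2::real) gchoose Suc n) / ((- 1) ^ Suc n /
      exp ((1/2 + 1) * of_real (ln (real (Suc n))))))) \<longlonglongrightarrow> real q / sqrt pi" .
  moreover have "- 2 * real q * (((1/2::real) gchoose Suc n) / ((- 1) ^ Suc n /
      exp ((1/2 + 1) * of_real (ln (real (Suc n)))))) =
      gf q 0 $ n * (1 / (4 * real q)) ^ n * real (Suc n) powr (3/2)" for n
  proof -
    have "(- 4 * real q) ^ Suc n * (1 / (4 * real q)) ^ n =
        - 4 * real q * (- 4 * real q * (1 / (4 * real q))) ^ n"
      by (simp only: power_Suc power_mult_distrib mult.assoc)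
    also have "- 4 * real q * (1 / (4 * real q)) = - 1"
      using assms by simp
    finally have "gf q 0 $ n * (1 / (4 * real q)) ^ n =
        - (1/2) * ((1/2::real) gchoose Suc n) * (- 4 * real q * (- 1) ^ n)"
      by (simp only: gf_0_nth binom_fps_def fps_nth_Abs_fps mult_ac)
    moreover have "exp ((1/2 + 1) * of_real (ln (real (Suc n)))) = real (Suc n) powr (3/2)"
      by (simp add: powr_def)
    ultimately show ?thesis
      by (cases "even n") simp_all
  qed
  ultimately show ?thesis
    unfolding coeff_limit_def by (simp only:)
qed

text \<open>Induction on \<open>j\<close> along the diagonal \<open>k + j = q\<close>, where the
  point \<open>1 / (4 * q)\<close> stays fixed; the product collects the values of
  \<open>(1 - 4 * k * x) powr (- 1/2)\<close> there.\<close>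

lemma coeff_limit_gf:
  assumes "q > 0" "k + j = q"
  shows "coeff_limit (1 / (4 * real q)) (gf k j)
    (real q / sqrt pi * (\<Prod>i\<in>{k..<q}. 1 / sqrt (1 - real i / real q)))"
  using assms(2)
proof (induction j arbitrary: k)
  case 0
  then show ?case using coeff_limit_gf_0[OF assms(1)] by simp
next
  case (Suc p)
  define r where "r = 1 / (4 * real q)"
  \<comment> \<open>A point beyond \<open>r\<close> at which \<open>4 * m * s < 1\<close> still
    holds for all \<open>m < q\<close>; the denominator is positive even for
    \<open>q = 1\<close>.\<close>
  define s where "s = 1 / (4 * real q - 2)"
  have s: "r > 0" "r < s" "s > 0"
    using assms(1) by (auto simp: r_def s_def intro!: divide_strict_left_mono mult_pos_pos)
  have conv: "4 * real m * s < 1" if "m < q" for m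
    using that by (simp add: s_def divide_less_eq)
  let ?B = "binom_fps (- 1/2) (- 4 * real k)"
  let ?S = "fps_X * (\<Sum>i\<in>{1..p}. gf k i * gf k (Suc p - i))"
  have B: "abs_conv s ?B"
    using conv[of k] s Suc.prems by (intro abs_conv_binom_fps) auto
  \<comment> \<open>Since \<open>1 \<le> i \<le> p\<close>, both factors have index sum below
    \<open>q\<close>.\<close>
  have "abs_conv s ?S"
    using Suc.prems by (intro abs_conv_mult abs_conv_sum abs_conv_X abs_conv_gf s conv) auto
  then have "coeff_limit r ?S 0"
    using s by (intro coeff_limit_abs_conv)
  moreover have "coeff_limit r (gf (Suc k) p)
      (real q / sqrt pi * (\<Prod>i\<in>{Suc k..<q}. 1 / sqrt (1 - real i / real q)))"
    unfolding r_def using Suc.prems by (intro Suc.IH) simp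
  ultimately have "coeff_limit r (gf (Suc k) p + ?S)
      (real q / sqrt pi * (\<Prod>i\<in>{Suc k..<q}. 1 / sqrt (1 - real i / real q)))"
    using coeff_limit_add by fastforce
  from coeff_limit_mult[OF B s(1,2) this]
  have "coeff_limit r (gf k (Suc p)) ((\<Sum>n. ?B $ n * r ^ n) *
      (real q / sqrt pi * (\<Prod>i\<in>{Suc k..<q}. 1 / sqrt (1 - real i / real q))))"
    unfolding gf_Suc[symmetric] .
  moreover have "(\<Sum>n. ?B $ n * r ^ n) = 1 / sqrt (1 - real k / real q)"
  proof -
    have "\<bar>- 4 * real k * r\<bar> < 1"
      using Suc.prems by (simp add: r_def)
    from sums_unique[OF binom_fps_sums[OF this, of "- 1/2"]]
    have "(\<Sum>n. ?B $ n * r ^ n) = (1 - real k / real q) powr (- (1/2))"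
      by (simp add: r_def)
    also have "\<dots> = 1 / sqrt (1 - real k / real q)"
      using Suc.prems by (simp add: powr_minus_divide powr_half_sqrt)
    finally show ?thesis .
  qed
  moreover have "{k..<q} = insert k {Suc k..<q}"
    using Suc.prems by auto
  ultimately show ?case
    unfolding r_def by (simp add: mult_ac)
qed

section \<open>Evaluation of the leading constant\<close>

lemma sqrt_prod: "sqrt (prod f A) = (\<Prod>x\<in>A. sqrt (f x))"
  by (induction A rule: infinite_finite_induct) (simp_all add: real_sqrt_mult)

text \<open>The radicands \<open>(q - i) / q\<close> multiply to \<open>q! / q ^ q\<close>;
  splitting \<open>q\<close> off \<open>q!\<close> leaves the \<open>(q - 1)!\<close> of the final
  formula.\<close>

lemma prod_inverse_sqrt:
  assumes "q > 0"
  shows "real q * (\<Prod>i\<in>{0..<q}. 1 / sqrt (1 - real i / real q)) * sqrt (fact (q - 1)) =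
    sqrt (real q) ^ (q + 1)"
proof -
  have "(\<Prod>i\<in>{0..<q}. 1 - real i / real q) = (\<Prod>i\<in>{0..<q}. real (q - i) / real q)"
    using assms by (intro prod.cong) (auto simp: of_nat_diff field_simps)
  also have "\<dots> = fact q / real q ^ q"
    by (simp add: prod_dividef fact_prod_rev)
  finally have "(\<Prod>i\<in>{0..<q}. 1 - real i / real q) = fact q / real q ^ q" .
  then have "(\<Prod>i\<in>{0..<q}. 1 / sqrt (1 - real i / real q)) = 1 / sqrt (fact q / real q ^ q)"
    by (simp only: prod_dividef prod.neutral_const flip: sqrt_prod)
  also have "fact q = real q * fact (q - 1)"
    using assms by (simp add: fact_reduce)
  also have "1 / sqrt (real q * fact (q - 1) / real q ^ q) =
      sqrt (real q) ^ q / (sqrt (real q) * sqrt (fact (q - 1)))"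
    by (simp add: real_sqrt_divide real_sqrt_mult real_sqrt_power)
  finally have P: "(\<Prod>i\<in>{0..<q}. 1 / sqrt (1 - real i / real q)) =
      sqrt (real q) ^ q / (sqrt (real q) * sqrt (fact (q - 1)))" .
  define x y where "x = sqrt (real q)" and "y = (sqrt (fact (q - 1)) :: real)"
  have xy: "x > 0" "y > 0" "real q = x * x"
    using assms by (simp_all add: x_def y_def)
  have "real q * (x ^ q / (x * y)) * y = x ^ (q + 1)"
    unfolding xy(3) using xy(1,2) by simp
  then show ?thesis
    unfolding P x_def y_def .
qed

lemma gf_div_asymptotic:
  assumes "q > 0"
  shows "(\<lambda>m. gf 0 q $ m / (sqrt 2 / (2 ^ q * sqrt (fact (q - 1)) * sqrt (pi * real (2 * m + 1 + q) ^ 3)) *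
    (2 * sqrt (real q)) ^ (2 * m + 1 + q))) \<longlonglongrightarrow> 1"
proof -
  define P where "P = (\<Prod>i\<in>{0..<q}. 1 / sqrt (1 - real i / real q))"
  \<comment> \<open>What remains of the reciprocal of the claimed term once
    \<open>(4 * q) ^ m\<close> and the root containing the size are removed.\<close>
  define c where "c = 2 ^ q * sqrt (fact (q - 1)) / (sqrt 2 * (2 * sqrt (real q)) ^ (q + 1))"
  have "(\<lambda>m. gf 0 q $ m * (1 / (4 * real q)) ^ m * real (Suc m) powr (3/2)) \<longlonglongrightarrow>
      real q / sqrt pi * P"
    using coeff_limit_gf[of q 0 q] assms by (simp add: coeff_limit_def P_def)
  \<comment> \<open>The size is about twice \<open>Suc m\<close>, so its cube contributes the factor
    8.\<close>
  moreover have "(\<lambda>m. sqrt (pi * real (2 * m + 1 + q) ^ 3) / real (Suc m) powr (3/2)) \<longlonglongrightarrow> sqrt (8 * pi)"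
  proof -
    have "(\<lambda>m. pi * (real (2 * m + 1 + q) / real (Suc m)) ^ 3) \<longlonglongrightarrow> pi * 2 ^ 3"
      by (intro tendsto_intros) real_asymp
    then have "(\<lambda>m. sqrt (pi * (real (2 * m + 1 + q) / real (Suc m)) ^ 3)) \<longlonglongrightarrow> sqrt (pi * 2 ^ 3)"
      by (rule tendsto_real_sqrt)
    moreover have "sqrt (pi * (real (2 * m + 1 + q) / real (Suc m)) ^ 3) =
        sqrt (pi * real (2 * m + 1 + q) ^ 3) / real (Suc m) powr (3/2)" for m
    proof -
      have "real (Suc m) powr (3/2) = sqrt (real (Suc m) ^ 3)"
        by (simp add: powr_half_sqrt[symmetric] powr_powr flip: powr_numeral)
      then show ?thesis
        by (simp add: power_divide real_sqrt_divide)
    qed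
    ultimately show ?thesis by (simp add: mult.commute)
  qed
  ultimately have "(\<lambda>m. (gf 0 q $ m * (1 / (4 * real q)) ^ m * real (Suc m) powr (3/2)) *
      (sqrt (pi * real (2 * m + 1 + q) ^ 3) / real (Suc m) powr (3/2)) * c) \<longlonglongrightarrow>
      real q / sqrt pi * P * sqrt (8 * pi) * c"
    by (intro tendsto_mult[OF tendsto_mult tendsto_const])
  also have "real q / sqrt pi * P * sqrt (8 * pi) * c = 1"
  proof -
    have "sqrt 8 = 2 * sqrt (2::real)"
      using real_sqrt_mult[of 4 2] by simp
    then have "real q / sqrt pi * P * sqrt (8 * pi) * c =
        2 * 2 ^ q * (real q * P * sqrt (fact (q - 1))) / (2 * sqrt (real q)) ^ (q + 1)"
      by (simp add: c_def real_sqrt_mult)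
    also have "\<dots> = 1"
      unfolding P_def prod_inverse_sqrt[OF assms] using assms by (simp add: power_mult_distrib)
    finally show ?thesis .
  qed
  finally have "(\<lambda>m. (gf 0 q $ m * (1 / (4 * real q)) ^ m * real (Suc m) powr (3/2)) *
      (sqrt (pi * real (2 * m + 1 + q) ^ 3) / real (Suc m) powr (3/2)) * c) \<longlonglongrightarrow> 1" .
  moreover have "(gf 0 q $ m * (1 / (4 * real q)) ^ m * real (Suc m) powr (3/2)) *
      (sqrt (pi * real (2 * m + 1 + q) ^ 3) / real (Suc m) powr (3/2)) * c =
      gf 0 q $ m / (sqrt 2 / (2 ^ q * sqrt (fact (q - 1)) * sqrt (pi * real (2 * m + 1 + q) ^ 3)) *
      (2 * sqrt (real q)) ^ (2 * m + 1 + q))" for m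
  proof -
    have "(2 * sqrt (real q)) ^ (2 * m + 1 + q) = (4 * real q) ^ m * (2 * sqrt (real q)) ^ (q + 1)"
      by (simp add: power_add power_mult power_mult_distrib)
    \<comment> \<open>Stated for arbitrary reals, so that simplification cannot rewrite the concrete
      subterms before they are matched.\<close>
    moreover have "(g * (1 / Q) ^ m * w) * (z / w) * (u * v / (t * e)) =
        g / (t / (u * v * z) * (Q ^ m * e))" if "w \<noteq> 0" for g Q w z u v t e :: real
      using that by (simp add: power_divide mult_ac)
    moreover have "real (Suc m) powr (3/2) \<noteq> 0" by simp
    ultimately show ?thesis
      unfolding c_def by (simp only:)
  qed
  ultimately show ?thesis by (simp only:)
qed

section \<open>From the number of binary nodes to the size\<close>

theorem proposition4:
  fixes q :: nat
  assumes "q \<ge> 1"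
  shows "(\<forall>n. [n = q] (mod 2) \<longrightarrow> card (closed_terms_of q n) = 0) \<and>
    (\<lambda>n. real (card (closed_terms_of q n)))
      \<sim>[inf at_top (principal {n. \<not> [n = q] (mod 2)})]
    (\<lambda>n. sqrt 2 / (2 ^ q * sqrt (fact (q - 1)) * sqrt (pi * real n ^ 3)) * (2 * sqrt (real q)) ^ n)"
proof (intro conjI allI impI)
  show "card (closed_terms_of q n) = 0" if "[n = q] (mod 2)" for n
    using closed_terms_of_parity[OF that] by simp
next
  let ?F = "inf at_top (principal {n. \<not> [n = q] (mod 2)})"
  let ?f = "\<lambda>n. real (card (closed_terms_of q n))"
  let ?g = "\<lambda>n. sqrt 2 / (2 ^ q * sqrt (fact (q - 1)) * sqrt (pi * real n ^ 3)) *
    (2 * sqrt (real q)) ^ n"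
  have lim: "(\<lambda>m. ?f (2 * m + 1 + q) / ?g (2 * m + 1 + q)) \<longlonglongrightarrow> 1"
    unfolding card_closed_terms_of using gf_div_asymptotic assms by simp
  \<comment> \<open>The map inverts \<open>m \<mapsto> 2 * m + 1 + q\<close> on sizes of the right
    parity.\<close>
  have "filterlim (\<lambda>n. (n - (1 + q)) div 2) at_top at_top"
    unfolding filterlim_at_top
  proof
    fix Z :: nat
    show "\<forall>\<^sub>F n in at_top. Z \<le> (n - (1 + q)) div 2"
      using eventually_ge_at_top[of "2 * Z + 1 + q"] by eventually_elim simp
  qed
  then have div2: "filterlim (\<lambda>n. (n - (1 + q)) div 2) at_top ?F"
    by (rule filterlim_mono) auto
  \<comment> \<open>The bound \<open>q < n\<close> keeps the natural subtraction from
    truncating.\<close>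
  have "2 * ((n - (1 + q)) div 2) + 1 + q = n" if "\<not> [n = q] (mod 2)" "q < n" for n
    using that unfolding Cong.cong_def by presburger
  then have "\<forall>\<^sub>F n in ?F. 2 * ((n - (1 + q)) div 2) + 1 + q = n"
    unfolding eventually_inf_principal
    by (intro eventually_mono[OF eventually_gt_at_top[of q]]) blast
  then have "\<forall>\<^sub>F n in ?F. ?f (2 * ((n - (1 + q)) div 2) + 1 + q) /
      ?g (2 * ((n - (1 + q)) div 2) + 1 + q) = ?f n / ?g n"
    by (rule eventually_mono) (simp only:)
  with filterlim_compose[OF lim div2] show "?f \<sim>[?F] ?g"
    by (intro asymp_equivI') (rule Lim_transform_eventually)
qed

end
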